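(* Let $X\in\mathcal{COP}(p)$ with $T_0\neq\emptyset$, let $\{\tau(j), j\in J\}$ be the set of its normalized minimal zeros, and let $\{J(s), s\in S\}$ be the set of all (distinct) maximal cliques of the minimal zeros graph $G(X)$. Suppose that the set $T_0$ of all normalized zeros of $X$ admits a representation $$T_0=\bigcup_{s\in\widetilde S}\widetilde T_0(s),$$ where $\widetilde S$ is a finite index set and $\widetilde T_0(s)$, $s\in\widetilde S$, are polytopes. Then $|\widetilde S|\ge |S|$, and the equality $|\widetilde S|=|S|$ implies that, up to renumbering (i.e. after identifying $\widetilde S$ with $S$ through a suitable bijection), $T_0(s):=\operatorname{conv}\{\tau(j), j\in J(s)\}=\widetilde T_0(s)$ for all $s\in S$.
   Context: Let $p\ge 2$ be an integer, $P=\{1,\dots,p\}$, and let $e_k$ be the standard basis vectors of $\mathbb R^p$. $\mathcal{COP}(p)$ is the cone of copositive matrices: real symmetric $p\times p$ matrices $X$ with $t^\top Xt\ge 0$ for all $t\in\mathbb R^p$, $t\ge \mathbf 0$ (componentwise). $T=\{t\in\mathbb R^p: t\ge\mathbf 0, \|t\|_1=1\}$, and $T_0=\{t\in T: t^\top Xt=0\}$ is the set of normalized zeros of $X$. For $t\ge\mathbf 0$, $\operatorname{supp}(t)=\{k\in P: t_k>0\}$. A normalized zero $\tau\in T_0$ is minimal if there is no $t\in T_0$ with $\operatorname{supp}(t)$ a strict subset of $\operatorname{supp}(\tau)$. There are finitely many normalized minimal zeros; they are indexed without repetition as $\tau(j)$, $j\in J$, with $J\subset\mathbb N$ finite. Put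 $M(j):=\{k\in P: e_k^\top X\tau(j)=0\}$, $j\in J$. The minimal zeros graph $G(X)=(J,V)$ is the undirected graph with vertex set $J$ and edge set $V=\{(i,j): i\in J, j\in J, i<j, \operatorname{supp}(\tau(i))\subset M(j)\}$. A clique is a subset of the vertex set in which every two distinct vertices are adjacent (singletons are cliques); a maximal clique is a clique that is not a proper subset of another clique. A polytope is the convex hull of finitely many points. The symbol $\subset$ allows equality. *)

theory Defs
  imports "HOL-Analysis.Analysis"
begin

text \<open>The index set \<open>{1, ..., p}\<close> is an arbitrary finite type \<^typ>\<open>'p\<close>; the order on
  \<^typ>\<open>real ^ 'p\<close> is the componentwise one.\<close>

definition copositive :: "real ^ 'p ^ 'p \<Rightarrow> bool" where
  "copositive X \<longleftrightarrow> transpose X = X \<and> (\<forall>t. 0 \<le> t \<longrightarrow> 0 \<le> t \<bullet> (X *v t))"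

definition simplexT :: "(real ^ 'p) set" where
  "simplexT = {t. 0 \<le> t \<and> (\<Sum>k\<in>UNIV. \<bar>t $ k\<bar>) = 1}"

definition zeros :: "real ^ 'p ^ 'p \<Rightarrow> (real ^ 'p) set" where
  "zeros X = {t \<in> simplexT. t \<bullet> (X *v t) = 0}"

definition supp :: "real ^ 'p \<Rightarrow> 'p set" where
  "supp t = {k. 0 < t $ k}"

definition minimal_zeros :: "real ^ 'p ^ 'p \<Rightarrow> (real ^ 'p) set" where
  "minimal_zeros X = {\<tau> \<in> zeros X. \<not> (\<exists>t \<in> zeros X. supp t \<subset> supp \<tau>)}"

definition Mset :: "real ^ 'p ^ 'p \<Rightarrow> real ^ 'p \<Rightarrow> 'p set" where
  "Mset X t = {k. axis k 1 \<bullet> (X *v t) = 0}"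

text \<open>An undirected edge \<open>{i, j}\<close> is encoded as the pair \<open>(i, j)\<close> with \<open>i < j\<close>.\<close>

definition zeros_graph_edges ::
    "real ^ 'p ^ 'p \<Rightarrow> nat set \<Rightarrow> (nat \<Rightarrow> real ^ 'p) \<Rightarrow> (nat \<times> nat) set" where
  "zeros_graph_edges X J \<tau> =
     {(i, j). i \<in> J \<and> j \<in> J \<and> i < j \<and> supp (\<tau> i) \<subseteq> Mset X (\<tau> j)}"

definition clique :: "nat set \<Rightarrow> (nat \<times> nat) set \<Rightarrow> nat set \<Rightarrow> bool" where
  "clique J V C \<longleftrightarrow>
     C \<subseteq> J \<and> (\<forall>i\<in>C. \<forall>j\<in>C. i \<noteq> j \<longrightarrow> (i, j) \<in> V \<or> (j, i) \<in> V)"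

definition maximal_clique :: "nat set \<Rightarrow> (nat \<times> nat) set \<Rightarrow> nat set \<Rightarrow> bool" where
  "maximal_clique J V C \<longleftrightarrow> clique J V C \<and> \<not> (\<exists>D. clique J V D \<and> C \<subset> D)"

text \<open>A minimal zero is determined by its support. Hence there are finitely many minimal zeros,
  and an injective enumeration by a finite set of natural numbers always exists.\<close>

lemma minimal_zeros_supp_inj:
  fixes X :: "real ^ 'p ^ 'p"
  assumes X: "copositive X"
  shows "inj_on supp (minimal_zeros X)"
proof (rule inj_onI, rule ccontr)
  fix t u assume t: "t \<in> minimal_zeros X" and u: "u \<in> minimal_zeros X"
    and eq: "supp t = supp u" and ne: "t \<noteq> u"
  have t0: "\<And>k. 0 \<le> t $ k" and u0: "\<And>k. 0 \<le> u $ k"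
    and ts: "(\<Sum>k\<in>UNIV. t $ k) = 1" and us: "(\<Sum>k\<in>UNIV. u $ k) = 1"
    and tz: "t \<bullet> (X *v t) = 0" and uz: "u \<bullet> (X *v u) = 0"
    using t u by (auto simp: minimal_zeros_def zeros_def simplexT_def less_eq_vec_def)
  have cop: "0 \<le> v \<bullet> (X *v v)" if "\<And>k. 0 \<le> v $ k" for v
    using X that by (auto simp: copositive_def less_eq_vec_def)
  have sym: "u \<bullet> (X *v t) = t \<bullet> (X *v u)"
    using X by (metis copositive_def dot_lmul_matrix inner_commute transpose_matrix_vector)
  have "supp u \<noteq> {}"
  proof
    assume "supp u = {}"
    then have "\<And>k. u $ k = 0" using u0 by (auto simp: supp_def order.order_iff_strict)
    then show False using us by simp
  qed
  define R where "R = (\<lambda>k. t $ k / u $ k) ` supp u"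
  define l where "l = Min R"
  have R: "finite R" "R \<noteq> {}" using \<open>supp u \<noteq> {}\<close> by (auto simp: R_def)
  then have "l \<in> R" unfolding l_def by (rule Min_in)
  then obtain m where m: "m \<in> supp u" "l = t $ m / u $ m" by (auto simp: R_def)
  have "m \<in> supp t" using m eq by simp
  then have l: "0 < l" using m by (simp add: supp_def)
  define w where "w = t - l *\<^sub>R u"
  have w0: "0 \<le> w $ k" for k
  proof (cases "k \<in> supp u")
    case True
    then have "l \<le> t $ k / u $ k" unfolding l_def using R by (intro Min_le) (auto simp: R_def)
    then show ?thesis using True by (simp add: w_def supp_def field_simps)
  next
    case False
    then have "u $ k = 0" using u0[of k] by (simp add: supp_def)
    then show ?thesis using t0 by (simp add: w_def)
  qed
  have wm: "w $ m = 0" using m by (simp add: w_def supp_def)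
  have wk: "k \<in> supp t" if "k \<in> supp w" for k
  proof -
    have "0 \<le> l * u $ k" using l u0[of k] by simp
    then show ?thesis using that by (simp add: supp_def w_def)
  qed
  have "m \<notin> supp w" using wm by (simp add: supp_def)
  then have wsub: "supp w \<subset> supp t"
    using wk \<open>m \<in> supp t\<close> by blast
  have wne: "w \<noteq> 0"
  proof
    assume "w = 0"
    then have tlu: "t = l *\<^sub>R u" by (simp add: w_def)
    have "(\<Sum>k\<in>UNIV. t $ k) = l * (\<Sum>k\<in>UNIV. u $ k)"
      by (simp add: tlu sum_distrib_left)
    then show False using ts us tlu ne by simp
  qed
  have ww: "w \<bullet> (X *v w) = - 2 * l * (t \<bullet> (X *v u))"
    using tz uz sym
    by (simp add: w_def matrix_vector_mult_diff_distrib matrix_vector_mult_scaleR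
        inner_diff_left inner_diff_right)
  have "(t + u) \<bullet> (X *v (t + u)) = 2 * (t \<bullet> (X *v u))"
    using tz uz sym
    by (simp add: matrix_vector_right_distrib inner_add_left inner_add_right)
  then have "0 \<le> t \<bullet> (X *v u)" using cop[of "t + u"] t0 u0 by simp
  then have wz: "w \<bullet> (X *v w) = 0"
    using ww cop[of w, OF w0] l by (simp add: mult_le_0_iff)
  define s where "s = (\<Sum>k\<in>UNIV. w $ k)"
  have "s \<noteq> 0"
  proof
    assume "s = 0"
    then have "\<And>k. w $ k = 0"
      using w0 by (simp add: s_def sum_nonneg_eq_0_iff)
    then show False using wne by (simp add: vec_eq_iff)
  qed
  moreover have "0 \<le> s" using w0 by (simp add: s_def sum_nonneg)
  ultimately have s: "0 < s" by simp
  have "(\<Sum>k\<in>UNIV. w $ k / s) = 1"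
    using s by (simp add: s_def flip: sum_divide_distrib)
  then have "(1 / s) *\<^sub>R w \<in> zeros X"
    using s w0 wz
    by (simp add: zeros_def simplexT_def less_eq_vec_def matrix_vector_mult_scaleR)
  moreover have "supp ((1 / s) *\<^sub>R w) = supp w"
    using s by (simp add: supp_def zero_less_divide_iff)
  ultimately show False
    using t wsub unfolding minimal_zeros_def mem_Collect_eq by metis
qed

lemma finite_minimal_zeros:
  fixes X :: "real ^ 'p ^ 'p"
  assumes "copositive X"
  shows "finite (minimal_zeros X)"
  using minimal_zeros_supp_inj[OF assms] by (rule inj_on_finite[of supp _ UNIV]) auto

lemma minimal_zeros_enumeration:
  fixes X :: "real ^ 'p ^ 'p"
  assumes "copositive X"
  shows "\<exists>(J :: nat set) \<tau>. finite J \<and> bij_betw \<tau> J (minimal_zeros X)"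
  using ex_bij_betw_nat_finite[OF finite_minimal_zeros[OF assms]] finite_atLeastLessThan by blast

end

theory Submission
  imports Defs
begin

text \<open>Write \<open>B t u = t \<bullet> (X *v u)\<close>. For zeros \<open>t\<close>, \<open>u\<close> one has \<open>B t u \<ge> 0\<close>, with equality
  iff \<open>supp t \<subseteq> Mset X u\<close>, so cliques are sets of pairwise \<open>B\<close>-orthogonal minimal
  zeros, and a convex set of zeros is pairwise \<open>B\<close>-orthogonal. Every zero \<open>u\<close> lies in the convex
  hull of the minimal zeros supported in \<open>supp u\<close>, and these form a clique. Let \<open>b\<close> be the barycentre
  of a maximal clique \<open>C\<close>. A convex set of zeros containing \<open>b\<close> lies in the hull of \<open>C\<close>, because
  its points are \<open>B\<close>-orthogonal to \<open>b\<close>, hence to \<open>C\<close>; and it contains the barycentre of no other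
  maximal clique. Choosing for each maximal clique a piece containing its barycentre is therefore
  injective. If it is bijective, a point \<open>x\<close> of the hull of \<open>C\<close> is the limit of points of the open
  segment from \<open>x\<close> to \<open>b\<close>, all of which lie in the piece chosen for \<open>C\<close>.\<close>

section \<open>The bilinear form on zeros\<close>

lemma simplexT_iff: "t \<in> simplexT \<longleftrightarrow> (\<forall>k. 0 \<le> t $ k) \<and> (\<Sum>k\<in>UNIV. t $ k) = 1"
  unfolding simplexT_def less_eq_vec_def
  by (auto simp: abs_of_nonneg cong: sum.cong)

lemma convex_simplexT: "convex simplexT"
  unfolding convex_def
  by (auto simp: simplexT_iff sum.distrib simp flip: sum_distrib_left)

lemma simplexT_nonneg: "t \<in> simplexT \<Longrightarrow> 0 \<le> t"
  by (simp add: simplexT_def)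

lemma simplexT_nonzero: "t \<in> simplexT \<Longrightarrow> t \<noteq> 0"
  by (auto simp: simplexT_iff)

lemma supp_nonempty:
  assumes "t \<in> simplexT"
  shows "supp t \<noteq> {}"
proof
  assume "supp t = {}"
  then have "t $ k \<le> 0" for k
    by (auto simp: supp_def not_less)
  then have "t = 0"
    using assms by (simp add: simplexT_iff vec_eq_iff order_antisym)
  then show False
    using simplexT_nonzero[OF assms] by simp
qed

lemma zerosD: "t \<in> zeros X \<Longrightarrow> t \<in> simplexT" "t \<in> zeros X \<Longrightarrow> t \<bullet> (X *v t) = 0"
  by (auto simp: zeros_def)

lemma zero_nonneg: "t \<in> zeros X \<Longrightarrow> 0 \<le> t"
  by (simp add: zerosD(1) simplexT_nonneg)

lemma minimal_zeros_subset: "minimal_zeros X \<subseteq> zeros X"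
  by (auto simp: minimal_zeros_def)

lemma form_commute:
  fixes X :: "real ^ 'p ^ 'p"
  assumes "copositive X"
  shows "t \<bullet> (X *v u) = u \<bullet> (X *v t)"
  using assms by (metis copositive_def dot_lmul_matrix inner_commute transpose_matrix_vector)

text \<open>If the coordinate \<open>g\<close> were negative, moving from \<open>t\<close> a little
  along the \<open>k\<close>-th axis would make the quadratic form negative: its linear term is
  \<open>2 * e * g\<close>, and the constant term vanishes because \<open>t\<close> is a
  zero.\<close>

lemma copositive_mult_zero_nonneg:
  fixes X :: "real ^ 'p ^ 'p"
  assumes X: "copositive X" and t: "t \<in> zeros X"
  shows "0 \<le> (X *v t) $ k"
proof (rule ccontr)
  define g where "g = (X *v t) $ k"
  define q where "q = axis k 1 \<bullet> (X *v axis k (1::real))"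
  \<comment> \<open>This step size gives \<open>e * q \<le> - g\<close>, so that
    \<open>2 * g + e * q \<le> g < 0\<close>; the summand 1 keeps the denominator positive.\<close>
  define e where "e = - g / (\<bar>q\<bar> + 1)"
  assume "\<not> 0 \<le> (X *v t) $ k"
  then have g: "g < 0"
    by (simp add: g_def)
  then have e: "0 < e"
    by (simp add: e_def divide_neg_pos add_nonneg_pos)
  have gk: "axis k 1 \<bullet> (X *v t) = g"
    by (simp add: g_def inner_axis')
  then have "t \<bullet> (X *v axis k 1) = g"
    using form_commute[OF X] by metis
  then have "(t + e *\<^sub>R axis k 1) \<bullet> (X *v (t + e *\<^sub>R axis k 1)) = e * (2 * g + e * q)"
    using gk zerosD(2)[OF t]
    by (simp add: matrix_vector_right_distrib matrix_vector_mult_scaleR inner_add_left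
        inner_add_right q_def algebra_simps)
  moreover have "0 \<le> t + e *\<^sub>R axis k 1"
    using zero_nonneg[OF t] e by (auto simp: less_eq_vec_def axis_def)
  ultimately have "0 \<le> e * (2 * g + e * q)"
    using X unfolding copositive_def by metis
  then have "0 \<le> 2 * g + e * q"
    using e by (simp add: zero_le_mult_iff)
  moreover have "e * q \<le> e * (\<bar>q\<bar> + 1)"
    using e by (intro mult_left_mono) auto
  moreover have "e * (\<bar>q\<bar> + 1) = - g"
    by (simp add: e_def add_nonneg_pos add_eq_0_iff)
  ultimately show False
    using g by linarith
qed

lemma form_nonneg:
  fixes X :: "real ^ 'p ^ 'p"
  assumes "copositive X" "0 \<le> t" "u \<in> zeros X"
  shows "0 \<le> t \<bullet> (X *v u)"
  using assms(2) copositive_mult_zero_nonneg[OF assms(1,3)]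
  by (auto simp: inner_vec_def less_eq_vec_def intro!: sum_nonneg)

text \<open>The form is a sum of the nonnegative products \<open>t $ k * (X *v u) $ k\<close>, so it
  vanishes only if each product does.\<close>

lemma form_eq_0_iff:
  fixes X :: "real ^ 'p ^ 'p"
  assumes X: "copositive X" and t: "0 \<le> t" and u: "u \<in> zeros X"
  shows "t \<bullet> (X *v u) = 0 \<longleftrightarrow> supp t \<subseteq> Mset X u"
proof -
  have "t \<bullet> (X *v u) = 0 \<longleftrightarrow> (\<forall>k. t $ k * (X *v u) $ k = 0)"
    using t copositive_mult_zero_nonneg[OF X u]
    by (simp add: inner_vec_def less_eq_vec_def sum_nonneg_eq_0_iff)
  also have "\<dots> \<longleftrightarrow> supp t \<subseteq> Mset X u"
    using t by (simp add: supp_def Mset_def inner_axis' less_eq_vec_def subset_iff)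
      (metis order.order_iff_strict order.irrefl)
  finally show ?thesis .
qed

lemma form_eq_0_mono:
  fixes X :: "real ^ 'p ^ 'p"
  assumes "copositive X" "0 \<le> s" "0 \<le> t" "u \<in> zeros X"
    and "supp s \<subseteq> supp t" "t \<bullet> (X *v u) = 0"
  shows "s \<bullet> (X *v u) = 0"
  using assms by (auto simp: form_eq_0_iff)

text \<open>The midpoint of \<open>t\<close> and \<open>u\<close> is again a zero, and expanding the
  form there leaves only the cross term.\<close>

lemma convex_zeros_form_eq_0:
  fixes X :: "real ^ 'p ^ 'p"
  assumes X: "copositive X" and K: "convex K" "K \<subseteq> zeros X" and t: "t \<in> K" and u: "u \<in> K"
  shows "t \<bullet> (X *v u) = 0"
proof -
  have "(1/2) *\<^sub>R t + (1/2) *\<^sub>R u \<in> K"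
    using K(1) t u by (intro convexD) auto
  then have "((1/2) *\<^sub>R t + (1/2) *\<^sub>R u) \<bullet> (X *v ((1/2) *\<^sub>R t + (1/2) *\<^sub>R u)) = 0"
    using K(2) zerosD(2) by blast
  moreover have "t \<bullet> (X *v t) = 0" "u \<bullet> (X *v u) = 0"
    using K(2) t u zerosD(2) by blast+
  ultimately show ?thesis
    using form_commute[OF X, of t u]
    by (simp add: matrix_vector_right_distrib matrix_vector_mult_scaleR inner_add_left
        inner_add_right)
qed

lemma convex_form_eq_0: "convex {t. a \<bullet> (X *v t) = 0}"
  for X :: "real ^ 'p ^ 'p"
  by (auto simp: convex_def matrix_vector_right_distrib matrix_vector_mult_scaleR inner_add_right)

text \<open>Orthogonality passes from \<open>A\<close> to its hull one argument at a time, because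
  being orthogonal to a fixed vector is a convex condition.\<close>

lemma convex_hull_zeros:
  fixes X :: "real ^ 'p ^ 'p"
  assumes X: "copositive X" and A: "A \<subseteq> zeros X"
    and orth: "\<And>a b. a \<in> A \<Longrightarrow> b \<in> A \<Longrightarrow> a \<bullet> (X *v b) = 0"
  shows "convex hull A \<subseteq> zeros X"
proof
  fix t assume t: "t \<in> convex hull A"
  have "convex hull A \<subseteq> {t. a \<bullet> (X *v t) = 0}" if "a \<in> A" for a
    using that orth by (intro hull_minimal convex_form_eq_0) auto
  then have "A \<subseteq> {u. t \<bullet> (X *v u) = 0}"
    using t form_commute[OF X, of t] by auto
  then have "convex hull A \<subseteq> {u. t \<bullet> (X *v u) = 0}"
    by (intro hull_minimal convex_form_eq_0)
  moreover have "convex hull A \<subseteq> simplexT"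
    using A zerosD(1) by (intro hull_minimal convex_simplexT) auto
  ultimately show "t \<in> zeros X"
    using t by (auto simp: zeros_def)
qed

section \<open>Decomposition into minimal zeros\<close>

text \<open>Subtract from \<open>t\<close> the largest multiple of \<open>u\<close> that leaves all
  coordinates nonnegative. This kills a coordinate of \<open>supp t\<close>, and the rescaled
  remainder is \<open>v\<close>.\<close>

lemma zero_split:
  fixes X :: "real ^ 'p ^ 'p"
  assumes X: "copositive X" and t: "t \<in> zeros X" and u: "u \<in> zeros X"
    and sub: "supp u \<subset> supp t"
  obtains v where "v \<in> zeros X" "supp v \<subset> supp t" "t \<in> closed_segment u v"
proof -
  define R where "R = (\<lambda>k. t $ k / u $ k) ` supp u"
  \<comment> \<open>The ratio test: \<open>l\<close> is the largest admissible multiple, and a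
    minimizing index \<open>m\<close> drops out of the support.\<close>
  define l where "l = Min R"
  have R: "finite R" "R \<noteq> {}"
    using supp_nonempty[OF zerosD(1)[OF u]] by (auto simp: R_def)
  then have "l \<in> R"
    unfolding l_def by (rule Min_in)
  then obtain m where m: "m \<in> supp u" "l = t $ m / u $ m"
    by (auto simp: R_def)
  have t0: "0 \<le> t $ k" and u0: "0 \<le> u $ k" for k
    using t u by (auto simp: zeros_def simplexT_iff)
  have ts: "(\<Sum>k\<in>UNIV. t $ k) = 1" and us: "(\<Sum>k\<in>UNIV. u $ k) = 1"
    using t u by (auto simp: zeros_def simplexT_iff)
  have "m \<in> supp t"
    using m sub by auto
  then have l: "0 < l"
    using m by (simp add: supp_def)
  define w where "w = t - l *\<^sub>R u"
  have w0: "0 \<le> w $ k" for k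
  proof (cases "k \<in> supp u")
    case True
    then have "l \<le> t $ k / u $ k"
      unfolding l_def using R by (intro Min_le) (auto simp: R_def)
    then show ?thesis
      using True by (simp add: w_def supp_def field_simps)
  next
    case False
    then have "u $ k = 0"
      using u0[of k] by (simp add: supp_def)
    then show ?thesis
      using t0 by (simp add: w_def)
  qed
  have "k \<in> supp t" if "k \<in> supp w" for k
  proof -
    have "0 \<le> l * u $ k"
      using l u0[of k] by simp
    then show ?thesis
      using that by (simp add: supp_def w_def)
  qed
  moreover have "m \<notin> supp w"
    using m by (simp add: supp_def w_def)
  ultimately have wsub: "supp w \<subset> supp t"
    using \<open>m \<in> supp t\<close> by blast
  \<comment> \<open>Strictness of the inclusion is used here: at \<open>n\<close> nothing is
    subtracted, so the remainder is nonzero and its mass \<open>1 - l\<close> is positive.\<close>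
  obtain n where n: "n \<in> supp t" "n \<notin> supp u"
    using sub by blast
  then have "0 < w $ n"
    using u0[of n] by (simp add: supp_def w_def)
  then have "0 < (\<Sum>k\<in>UNIV. w $ k)"
    using w0 by (intro sum_pos2[of UNIV n]) auto
  moreover have ws: "(\<Sum>k\<in>UNIV. w $ k) = 1 - l"
    by (simp add: w_def sum_subtractf ts us flip: sum_distrib_left)
  ultimately have l1: "l < 1"
    by simp
  have "u \<bullet> (X *v t) = 0"
    using sub zerosD(2)[OF t]
    by (intro form_eq_0_mono[OF X zero_nonneg[OF u] zero_nonneg[OF t] t]) auto
  then have ww: "w \<bullet> (X *v w) = 0"
    using form_commute[OF X, of t u] zerosD(2)[OF t] zerosD(2)[OF u]
    by (simp add: w_def matrix_vector_mult_diff_distrib matrix_vector_mult_scaleR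
        inner_diff_left inner_diff_right)
  define v where "v = (1 / (1 - l)) *\<^sub>R w"
  have "(\<Sum>k\<in>UNIV. w $ k / (1 - l)) = 1"
    using ws l1 by (simp flip: sum_divide_distrib)
  then have "v \<in> zeros X"
    using w0 ww l1 by (simp add: v_def zeros_def simplexT_iff matrix_vector_mult_scaleR)
  moreover have "supp v = supp w"
    using l1 by (simp add: v_def supp_def zero_less_divide_iff)
  moreover have "t = (1 - (1 - l)) *\<^sub>R u + (1 - l) *\<^sub>R v"
    using l1 by (simp add: v_def w_def)
  then have "t \<in> closed_segment u v"
    using l l1 by (auto simp: in_segment intro!: exI[of _ "1 - l"])
  ultimately show ?thesis
    using that wsub by metis
qed

text \<open>Induction on the size of the support: a zero that is not minimal lies on a segment
  between two zeros of strictly smaller support.\<close>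

lemma zero_in_hull_minimal_zeros:
  fixes X :: "real ^ 'p ^ 'p"
  assumes X: "copositive X" and t: "t \<in> zeros X"
  shows "t \<in> convex hull {m \<in> minimal_zeros X. supp m \<subseteq> supp t}"
  using t
proof (induction "card (supp t)" arbitrary: t rule: less_induct)
  case less
  let ?A = "\<lambda>t. {m \<in> minimal_zeros X. supp m \<subseteq> supp t}"
  have IH: "s \<in> convex hull ?A t" if "s \<in> zeros X" "supp s \<subset> supp t" for s
  proof -
    have "s \<in> convex hull ?A s"
      using that by (intro less.hyps psubset_card_mono) auto
    moreover have "convex hull ?A s \<subseteq> convex hull ?A t"
      using that by (intro hull_mono) auto
    ultimately show ?thesis
      by blast
  qed
  show ?case
  proof (cases "t \<in> minimal_zeros X")
    case True
    then show ?thesis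
      by (intro hull_inc) auto
  next
    case False
    then obtain u where u: "u \<in> zeros X" "supp u \<subset> supp t"
      using less.prems by (auto simp: minimal_zeros_def)
    obtain v where v: "v \<in> zeros X" "supp v \<subset> supp t" "t \<in> closed_segment u v"
      using zero_split[OF X less.prems u] .
    have "closed_segment u v \<subseteq> convex hull ?A t"
      using IH u v by (intro closed_segment_subset convex_convex_hull) auto
    then show ?thesis
      using v by blast
  qed
qed

text \<open>Starting from \<open>B t t = 0\<close>, shrink the support in one argument to get
  \<open>B n t = 0\<close>, swap, and shrink in the other.\<close>

lemma minimal_zeros_in_supp_orthogonal:
  fixes X :: "real ^ 'p ^ 'p"
  assumes X: "copositive X" and t: "t \<in> zeros X"
    and m: "m \<in> zeros X" "supp m \<subseteq> supp t" and n: "n \<in> zeros X" "supp n \<subseteq> supp t"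
  shows "m \<bullet> (X *v n) = 0"
proof -
  have "n \<bullet> (X *v t) = 0"
    using form_eq_0_mono[OF X _ _ t n(2)] zero_nonneg n t zerosD(2)[OF t] by blast
  then have "t \<bullet> (X *v n) = 0"
    using form_commute[OF X] by metis
  then show ?thesis
    using form_eq_0_mono[OF X _ _ n(1) m(2)] zero_nonneg m t by blast
qed

text \<open>With positive weights on nonnegative vectors, no positive coordinate can cancel.\<close>

lemma barycentre_supp:
  fixes A :: "(real ^ 'p) set"
  assumes "finite A" "A \<noteq> {}" and nonneg: "\<And>a. a \<in> A \<Longrightarrow> 0 \<le> a"
  obtains b where "b \<in> convex hull A" "\<And>a. a \<in> A \<Longrightarrow> supp a \<subseteq> supp b"
proof
  let ?b = "\<Sum>a\<in>A. (1 / real (card A)) *\<^sub>R a"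
  have c: "0 < real (card A)"
    using assms by (simp add: card_gt_0_iff)
  then show "?b \<in> convex hull A"
    using assms by (intro convex_sum) (auto intro: hull_inc)
  fix a assume a: "a \<in> A"
  show "supp a \<subseteq> supp ?b"
  proof
    fix k assume "k \<in> supp a"
    then have "0 < (\<Sum>a\<in>A. (1 / real (card A)) * a $ k)"
      using a c assms
      by (intro sum_pos2[of A a]) (auto simp: supp_def less_eq_vec_def)
    then show "k \<in> supp ?b"
      by (simp add: supp_def)
  qed
qed

section \<open>Maximal cliques\<close>

text \<open>The inclusion defining an edge is symmetric, being equivalent to
  \<open>B\<close>-orthogonality, so the order \<open>i < j\<close> is immaterial. The diagonal case
  holds since each \<open>\<tau> i\<close> is a zero.\<close>

lemma clique_zeros_graph_iff:
  fixes X :: "real ^ 'p ^ 'p"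
  assumes X: "copositive X" and \<tau>: "\<tau> ` J \<subseteq> zeros X"
  shows "clique J (zeros_graph_edges X J \<tau>) C \<longleftrightarrow>
    C \<subseteq> J \<and> (\<forall>i\<in>C. \<forall>j\<in>C. \<tau> i \<bullet> (X *v \<tau> j) = 0)"
proof -
  have edge: "(i \<noteq> j \<longrightarrow>
      (i, j) \<in> zeros_graph_edges X J \<tau> \<or> (j, i) \<in> zeros_graph_edges X J \<tau>) \<longleftrightarrow>
      \<tau> i \<bullet> (X *v \<tau> j) = 0" if "i \<in> J" "j \<in> J" for i j
  proof -
    have z: "\<tau> i \<in> zeros X" "\<tau> j \<in> zeros X"
      using \<tau> that by auto
    have "supp (\<tau> i) \<subseteq> Mset X (\<tau> j) \<longleftrightarrow> \<tau> i \<bullet> (X *v \<tau> j) = 0"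
      "supp (\<tau> j) \<subseteq> Mset X (\<tau> i) \<longleftrightarrow> \<tau> i \<bullet> (X *v \<tau> j) = 0"
      using form_eq_0_iff[OF X] z zero_nonneg form_commute[OF X, of "\<tau> i"] by metis+
    moreover have "i = j \<Longrightarrow> \<tau> i \<bullet> (X *v \<tau> j) = 0"
      using z zerosD(2) by blast
    ultimately show ?thesis
      using that by (cases i j rule: linorder_cases) (auto simp: zeros_graph_edges_def)
  qed
  show ?thesis
    unfolding clique_def using edge by (intro conj_cong ball_cong refl) blast
qed

lemma maximal_clique_nonempty:
  assumes "J \<noteq> {}" "maximal_clique J V C"
  shows "C \<noteq> {}"
proof
  assume "C = {}"
  obtain j where "j \<in> J"
    using assms by auto
  then have "clique J V {j}"
    by (simp add: clique_def)
  then show False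
    using assms \<open>C = {}\<close> unfolding maximal_clique_def by blast
qed

text \<open>Under these orthogonality relations \<open>C \<union> D\<close> is a clique, so
  maximality gives \<open>C \<union> D = C\<close>.\<close>

lemma maximal_clique_absorb:
  fixes X :: "real ^ 'p ^ 'p"
  assumes X: "copositive X" and \<tau>: "\<tau> ` J \<subseteq> zeros X"
    and C: "maximal_clique J (zeros_graph_edges X J \<tau>) C"
    and D: "clique J (zeros_graph_edges X J \<tau>) D"
    and orth: "\<And>i j. i \<in> D \<Longrightarrow> j \<in> C \<Longrightarrow> \<tau> i \<bullet> (X *v \<tau> j) = 0"
  shows "D \<subseteq> C"
proof -
  have orth': "\<tau> j \<bullet> (X *v \<tau> i) = 0" if "i \<in> D" "j \<in> C" for i j
    using orth[OF that] form_commute[OF X] by metis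
  have "clique J (zeros_graph_edges X J \<tau>) (C \<union> D)"
    using C D orth orth' unfolding maximal_clique_def clique_zeros_graph_iff[OF X \<tau>]
    by (simp add: ball_Un)
  then show ?thesis
    using C unfolding maximal_clique_def by blast
qed

text \<open>The minimal zeros supported in \<open>supp u\<close> form a clique, inherit from
  \<open>u\<close> the orthogonality to \<open>C\<close>, and are therefore absorbed by
  \<open>C\<close>; their hull contains \<open>u\<close>.\<close>

lemma zero_in_maximal_clique_hull:
  fixes X :: "real ^ 'p ^ 'p"
  assumes X: "copositive X" and \<tau>: "\<tau> ` J = minimal_zeros X"
    and C: "maximal_clique J (zeros_graph_edges X J \<tau>) C"
    and u: "u \<in> zeros X" and orth: "\<And>j. j \<in> C \<Longrightarrow> u \<bullet> (X *v \<tau> j) = 0"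
  shows "u \<in> convex hull (\<tau> ` C)"
proof -
  define D where "D = {i \<in> J. supp (\<tau> i) \<subseteq> supp u}"
  have \<tau>z: "\<tau> ` J \<subseteq> zeros X"
    using \<tau> minimal_zeros_subset by blast
  have CJ: "C \<subseteq> J"
    using C by (simp add: maximal_clique_def clique_def)
  have "D \<subseteq> C"
  proof (rule maximal_clique_absorb[OF X \<tau>z C])
    show "clique J (zeros_graph_edges X J \<tau>) D"
      unfolding clique_zeros_graph_iff[OF X \<tau>z]
      using \<tau>z by (auto simp: D_def intro!: minimal_zeros_in_supp_orthogonal[OF X u])
  next
    fix i j assume "i \<in> D" "j \<in> C"
    then show "\<tau> i \<bullet> (X *v \<tau> j) = 0"
      using \<tau>z CJ u by (intro form_eq_0_mono[OF X _ _ _ _ orth])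
        (auto simp: D_def intro: zero_nonneg)
  qed
  moreover have "{m \<in> minimal_zeros X. supp m \<subseteq> supp u} = \<tau> ` D"
    unfolding D_def \<tau>[symmetric] by auto
  then have "u \<in> convex hull (\<tau> ` D)"
    using zero_in_hull_minimal_zeros[OF X u] by simp
  ultimately show ?thesis
    using hull_mono[of "\<tau> ` D" "\<tau> ` C"] by blast
qed

theorem proposition4:
  fixes X :: "real ^ 'p ^ 'p"
    and J :: "nat set" and \<tau> :: "nat \<Rightarrow> real ^ 'p"
    and S :: "'s set" and Jc :: "'s \<Rightarrow> nat set"
    and S' :: "'r set" and T' :: "'r \<Rightarrow> (real ^ 'p) set"
  assumes "CARD('p) \<ge> 2"
    and "copositive X"
    and "zeros X \<noteq> {}"
    and "finite J"
    and "bij_betw \<tau> J (minimal_zeros X)"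
    and "bij_betw Jc S {C. maximal_clique J (zeros_graph_edges X J \<tau>) C}"
    and "finite S'"
    and "\<And>s. s \<in> S' \<Longrightarrow> polytope (T' s)"
    and "zeros X = (\<Union>s\<in>S'. T' s)"
  shows "card S' \<ge> card S \<and>
    (card S' = card S \<longrightarrow>
      (\<exists>\<pi>. bij_betw \<pi> S S' \<and> (\<forall>s\<in>S. convex hull (\<tau> ` Jc s) = T' (\<pi> s))))"
proof -
  note X = assms(2) and T' = assms(9)
  let ?V = "zeros_graph_edges X J \<tau>"
  have \<tau>: "\<tau> ` J = minimal_zeros X"
    using assms(5) by (simp add: bij_betw_def)
  then have \<tau>z: "\<tau> ` J \<subseteq> zeros X"
    using minimal_zeros_subset by blast
  have "J \<noteq> {}"
    using zero_in_hull_minimal_zeros[OF X] assms(3) \<tau> by fastforce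
  have max: "maximal_clique J ?V (Jc s)" if "s \<in> S" for s
    using assms(6) that by (auto simp: bij_betw_def)
  have JcJ: "Jc s \<subseteq> J" and hull_zeros: "convex hull (\<tau> ` Jc s) \<subseteq> zeros X" if "s \<in> S" for s
  proof -
    have c: "clique J ?V (Jc s)"
      using max[OF that] by (simp add: maximal_clique_def)
    then show "Jc s \<subseteq> J"
      by (simp add: clique_def)
    then show "convex hull (\<tau> ` Jc s) \<subseteq> zeros X"
      using c \<tau>z unfolding clique_zeros_graph_iff[OF X \<tau>z]
      by (intro convex_hull_zeros[OF X]) auto
  qed
  have "\<exists>b. b \<in> convex hull (\<tau> ` Jc s) \<and> (\<forall>j\<in>Jc s. supp (\<tau> j) \<subseteq> supp b)" if s: "s \<in> S" for s
  proof (rule barycentre_supp[of "\<tau> ` Jc s"])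
    show "finite (\<tau> ` Jc s)"
      using JcJ[OF s] assms(4) finite_subset by blast
    show "\<tau> ` Jc s \<noteq> {}"
      using maximal_clique_nonempty[OF \<open>J \<noteq> {}\<close> max[OF s]] by simp
    show "0 \<le> a" if "a \<in> \<tau> ` Jc s" for a
      using that JcJ[OF s] \<tau>z zero_nonneg by blast
  qed auto
  then obtain b where b: "\<And>s. s \<in> S \<Longrightarrow> b s \<in> convex hull (\<tau> ` Jc s)"
    and bsupp: "\<And>s j. s \<in> S \<Longrightarrow> j \<in> Jc s \<Longrightarrow> supp (\<tau> j) \<subseteq> supp (b s)"
    by metis
  have bz: "b s \<in> zeros X" if "s \<in> S" for s
    using b hull_zeros that by blast
  \<comment> \<open>Orthogonality to the barycentre passes to each vertex, whose support is
    contained in that of \<open>b s\<close>.\<close>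
  have borth: "u \<bullet> (X *v \<tau> j) = 0"
    if "s \<in> S" "u \<in> zeros X" "u \<bullet> (X *v b s) = 0" "j \<in> Jc s" for s u j
  proof -
    have "\<tau> j \<bullet> (X *v u) = 0"
      using that JcJ[OF that(1)] \<tau>z bz[OF that(1)] bsupp form_commute[OF X, of u]
      by (intro form_eq_0_mono[OF X _ _ _ bsupp[OF that(1) that(4)]]) (auto intro: zero_nonneg)
    then show ?thesis
      using form_commute[OF X] by metis
  qed
  \<comment> \<open>Applying \<open>borth\<close> in both arguments turns orthogonal barycentres
    into orthogonal cliques, and two such maximal cliques coincide.\<close>
  have same: "r = s" if rs: "r \<in> S" "s \<in> S" and 0: "b r \<bullet> (X *v b s) = 0" for r s
  proof -
    have *: "\<tau> i \<bullet> (X *v \<tau> j) = 0" if "i \<in> Jc r" "j \<in> Jc s" for i j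
    proof -
      have "b s \<bullet> (X *v b r) = 0"
        using 0 form_commute[OF X] by metis
      then have "b s \<bullet> (X *v \<tau> i) = 0"
        using borth[OF rs(1) bz[OF rs(2)] _ that(1)] by blast
      then have "\<tau> i \<bullet> (X *v b s) = 0"
        using form_commute[OF X] by metis
      then show ?thesis
        using that JcJ[OF rs(1)] \<tau>z by (intro borth[OF rs(2)]) auto
    qed
    have "Jc r \<subseteq> Jc s"
      using max rs * by (intro maximal_clique_absorb[OF X \<tau>z]) (auto simp: maximal_clique_def)
    then have "Jc r = Jc s"
      using max rs unfolding maximal_clique_def by blast
    then show ?thesis
      using assms(6) rs by (auto simp: bij_betw_def inj_on_def)
  qed
  have "\<exists>r\<in>S'. b s \<in> T' r" if "s \<in> S" for s
    using bz[OF that] T' by blast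
  then obtain \<pi> where \<pi>: "\<And>s. s \<in> S \<Longrightarrow> \<pi> s \<in> S'" "\<And>s. s \<in> S \<Longrightarrow> b s \<in> T' (\<pi> s)"
    by metis
  have orthT': "t \<bullet> (X *v u) = 0" if "r \<in> S'" "t \<in> T' r" "u \<in> T' r" for r t u
    using that assms(8) T' by (intro convex_zeros_form_eq_0[OF X, of "T' r"])
      (auto intro: polytope_imp_convex)
  have inj: "inj_on \<pi> S"
  proof (rule inj_onI)
    fix r s assume rs: "r \<in> S" "s \<in> S" "\<pi> r = \<pi> s"
    then have "b r \<bullet> (X *v b s) = 0"
      using orthT'[OF \<pi>(1)[OF rs(2)]] \<pi>(2) by metis
    then show "r = s"
      by (rule same[OF rs(1,2)])
  qed
  have "\<pi> ` S \<subseteq> S'"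
    using \<pi> by auto
  with inj have le: "card S \<le> card S'"
    using assms(7) by (rule card_inj_on_le)
  have sub: "T' (\<pi> s) \<subseteq> convex hull (\<tau> ` Jc s)" if s: "s \<in> S" for s
  proof
    fix u assume u: "u \<in> T' (\<pi> s)"
    then have uz: "u \<in> zeros X"
      using T' \<pi> s by blast
    show "u \<in> convex hull (\<tau> ` Jc s)"
      using borth[OF s uz] orthT'[OF \<pi>(1)[OF s] u \<pi>(2)[OF s]]
      by (intro zero_in_maximal_clique_hull[OF X \<tau> max[OF s] uz]) auto
  qed
  have sup: "convex hull (\<tau> ` Jc s) \<subseteq> T' (\<pi> s)" if s: "s \<in> S" and surj: "\<pi> ` S = S'" for s
  proof
    fix x assume x: "x \<in> convex hull (\<tau> ` Jc s)"
    have cl: "closed (T' (\<pi> s))"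
      using assms(8) \<pi> s by (simp add: polytope_imp_closed)
    have "open_segment (b s) x \<subseteq> T' (\<pi> s)"
    proof
      fix y assume y: "y \<in> open_segment (b s) x"
      then obtain c where c: "0 < c" "c < 1" "y = (1 - c) *\<^sub>R b s + c *\<^sub>R x"
        by (auto simp: in_segment)
      have "closed_segment (b s) x \<subseteq> convex hull (\<tau> ` Jc s)"
        using b s x by (intro closed_segment_subset convex_convex_hull) auto
      then have "y \<in> zeros X"
        using y hull_zeros[OF s] open_closed_segment by blast
      then obtain r where r: "r \<in> S" "y \<in> T' (\<pi> r)"
        using T' surj by blast
      \<comment> \<open>Both terms of this convex combination are nonnegative, and
        \<open>b s\<close> has the positive weight \<open>1 - c\<close>, so \<open>b s\<close> is
        orthogonal to \<open>b r\<close>. At \<open>x\<close> itself this weight would be 0, hence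
        the open segment.\<close>
      have "y \<bullet> (X *v b r) = 0"
        using orthT' r \<pi> by blast
      then have "(1 - c) * (b s \<bullet> (X *v b r)) + c * (x \<bullet> (X *v b r)) = 0"
        by (simp add: c inner_add_left)
      moreover have "0 \<le> b s \<bullet> (X *v b r)" "0 \<le> x \<bullet> (X *v b r)"
        using hull_zeros[OF s] x s r by (auto intro!: form_nonneg[OF X] bz intro: zero_nonneg)
      ultimately have "(1 - c) * (b s \<bullet> (X *v b r)) = 0"
        using c by (smt (verit) mult_nonneg_nonneg)
      then have "s = r"
        using c s r by (intro same) auto
      then show "y \<in> T' (\<pi> s)"
        using r by simp
    qed
    then have "closure (open_segment (b s) x) \<subseteq> T' (\<pi> s)"
      using cl by (rule closure_minimal)
    \<comment> \<open>For \<open>x \<noteq> b s\<close> the closure of the open segment contains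
      \<open>x\<close>; the degenerate case is the choice of \<open>\<pi> s\<close>.\<close>
    then show "x \<in> T' (\<pi> s)"
      using \<pi>(2)[OF s] by (cases "x = b s") auto
  qed
  have "\<pi> ` S = S'" if "card S' = card S"
    using that \<open>\<pi> ` S \<subseteq> S'\<close> assms(7) inj by (intro card_subset_eq) (auto simp: card_image)
  moreover have "convex hull (\<tau> ` Jc s) = T' (\<pi> s)" if "\<pi> ` S = S'" "s \<in> S" for s
    using sub[OF that(2)] sup[OF that(2,1)] by (rule equalityI[rotated])
  ultimately show ?thesis
    using le inj unfolding bij_betw_def by blast
qed

end
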